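(* Let $\alpha>0$ be real, let $1\le\delta\le\Delta$ be integers, and let $G$ be a graph with minimum degree $\delta$ and maximum degree $\Delta$. If $\Delta(\delta+1)$ is even, then $M_1^\alpha(G)\ge\Delta\delta^{2\alpha}+\Delta^{2\alpha}$. If $\Delta(\delta+1)$ is odd, then $M_1^\alpha(G)\ge(\Delta-1)\delta^{2\alpha}+(\delta+1)^{2\alpha}+\Delta^{2\alpha}$. These inequalities are sharp.
   Context: All graphs are finite, simple and have at least one edge; $d_u$ is the degree of $u$. The first variable Zagreb index is $M_1^\alpha(G)=\sum_{u\in V(G)}d_u^{2\alpha}$. *)

theory Defs
  imports Complex_Main "Graph_Theory.Digraph"
begin

(* The locale predicate "graph" of Graph_Theory describes finite simple graphs as finite symmetric
   digraphs without loops and parallel arcs: an undirected edge uv is the pair of arcs (u,v), (v,u).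
   Hence the degree d_u is the out-degree of u, and at least one edge means at least one arc. *)

definition nontrivial_graph :: "('a, 'b) pre_digraph \<Rightarrow> bool" where
  "nontrivial_graph G \<longleftrightarrow> graph G \<and> arcs G \<noteq> {}"

definition degree :: "('a, 'b) pre_digraph \<Rightarrow> 'a \<Rightarrow> nat" where
  "degree G u = out_degree G u"

definition min_degree :: "('a, 'b) pre_digraph \<Rightarrow> nat" where
  "min_degree G = Min (degree G ` verts G)"

definition max_degree :: "('a, 'b) pre_digraph \<Rightarrow> nat" where
  "max_degree G = Max (degree G ` verts G)"

definition first_variable_Zagreb :: "real \<Rightarrow> ('a, 'b) pre_digraph \<Rightarrow> real" where
  "first_variable_Zagreb \<alpha> G = (\<Sum>u\<in>verts G. real (degree G u) powr (2 * \<alpha>))"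

end

theory Submission
  imports Defs
begin

text \<open>
  A vertex of degree \<open>\<Delta>\<close> together with its neighbours gives at least \<open>\<Delta> + 1\<close> vertices, all of degree
  at least \<open>\<delta>\<close>. If \<open>\<Delta>(\<delta> + 1)\<close> is odd, then \<open>\<Delta>\<close> is odd and \<open>\<delta>\<close> is even, so by the handshake lemma
  some second vertex has odd degree, which is at least \<open>\<delta> + 1\<close>. Equality is attained by the cone over
  a graph on \<open>\<Delta>\<close> vertices that is \<open>(\<delta> - 1)\<close>-regular, respectively has all degrees \<open>\<delta> - 1\<close> except for
  a single \<open>\<delta>\<close>. Such graphs are obtained by joining \<open>i, j < \<Delta>\<close> whenever \<open>\<bar>i - j\<bar>\<close> lies in a
  suitable set.
\<close>

section \<open>Lower bounds\<close>

text \<open>Swapping components is an involution of \<open>A\<close>. It has no fixed points because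
  \<open>A\<close> is irreflexive, so its orbits split \<open>A\<close> into pairs.\<close>

lemma even_card_sym_irrefl:
  assumes "finite A" "sym A" "irrefl A"
  shows "even (card A)"
proof -
  let ?C = "(\<lambda>p. {p, prod.swap p}) ` A"
  have union: "\<Union>?C = A"
    using \<open>sym A\<close> by (auto dest: symD)
  have "2 * card ?C = card (\<Union>?C)"
  proof (rule card_partition)
    show "finite ?C"
      using \<open>finite A\<close> by (rule finite_imageI)
    show "finite (\<Union>?C)"
      unfolding union by (rule \<open>finite A\<close>)
    fix c assume "c \<in> ?C"
    then obtain p where "p \<in> A" "c = {p, prod.swap p}"
      by (elim imageE)
    moreover from this have "p \<noteq> prod.swap p"
      using \<open>irrefl A\<close> by (cases p) (auto simp: irrefl_def)
    ultimately show "card c = 2"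
      by simp
  next
    \<comment> \<open>Each orbit is determined by any of its elements, so two orbits that meet
      coincide.\<close>
    have pair: "c = {x, prod.swap x}" if c: "c \<in> ?C" and x: "x \<in> c" for c x
    proof -
      obtain p where p: "c = {p, prod.swap p}"
        using c by (elim imageE)
      with x consider "x = p" | "x = prod.swap p"
        by blast
      then show ?thesis
        by cases (simp_all add: p insert_commute)
    qed
    fix c1 c2 assume c: "c1 \<in> ?C" "c2 \<in> ?C" "c1 \<noteq> c2"
    show "c1 \<inter> c2 = {}"
    proof (rule ccontr)
      assume "c1 \<inter> c2 \<noteq> {}"
      then obtain x where x: "x \<in> c1" "x \<in> c2"
        by blast
      have "c1 = c2"
        by (rule trans[OF pair[OF c(1) x(1)] pair[OF c(2) x(2), symmetric]])
      with c(3) show False ..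
    qed
  qed
  then show ?thesis
    unfolding union by (metis dvd_triv_left)
qed

text \<open>Every arc leaves exactly one vertex, so the sum counts arcs. Without parallel arcs these
  correspond to their pairs of ends, which form a symmetric relation, irreflexive because there are
  no loops.\<close>

lemma (in graph) even_sum_degree: "even (\<Sum>u\<in>verts G. degree G u)"
proof -
  have "(\<Sum>u\<in>verts G. degree G u) = card (\<Union>u\<in>verts G. out_arcs G u)"
    unfolding degree_def out_degree_def
    by (subst card_UN_disjoint) auto
  also have "(\<Union>u\<in>verts G. out_arcs G u) = arcs G"
    by auto
  also have "card (arcs G) = card (arcs_ends G)"
    unfolding arcs_ends_def by (rule card_image[OF inj_on_arc_to_ends, symmetric])
  also have "even \<dots>"
  proof (rule even_card_sym_irrefl)
    show "finite (arcs_ends G)"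
      by (simp add: arcs_ends_def)
    show "sym (arcs_ends G)"
      using sym_arcs by (simp add: symmetric_def)
    show "irrefl (arcs_ends G)"
      using adj_not_same by (auto simp: irrefl_def)
  qed
  finally show ?thesis .
qed

section \<open>Vertex counts and the two lower bounds\<close>

lemma (in graph) degree_less_card_verts:
  assumes "u \<in> verts G"
  shows "degree G u < card (verts G)"
proof -
  \<comment> \<open>Distinct arcs out of \<open>u\<close> have distinct heads, and none of these
    heads is \<open>u\<close>.\<close>
  have "inj_on (head G) (out_arcs G u)"
    using no_multi_arcs by (auto intro!: inj_onI simp: arc_to_ends_def)
  moreover have "head G ` out_arcs G u \<subseteq> verts G - {u}"
    using no_loops by auto
  ultimately have "degree G u \<le> card (verts G - {u})"
    unfolding degree_def out_degree_def by (intro card_inj_on_le) auto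
  also have "\<dots> < card (verts G)"
    using assms by (intro psubset_card_mono) auto
  finally show ?thesis .
qed

lemma (in graph) min_degree_le: "u \<in> verts G \<Longrightarrow> min_degree G \<le> degree G u"
  by (simp add: min_degree_def)

lemma (in graph) obtain_max_degree:
  assumes "verts G \<noteq> {}"
  obtains u where "u \<in> verts G" "degree G u = max_degree G"
proof -
  have "max_degree G \<in> degree G ` verts G"
    unfolding max_degree_def using assms by (intro Max_in) auto
  then show ?thesis
    using that by auto
qed

text \<open>Serves both bounds: the terms in \<open>A\<close> are kept exactly and all others are
  replaced by \<open>c\<close>. Since \<open>m\<close> only bounds the number of the others from
  below, surplus terms are dropped, which needs \<open>0 \<le> c\<close>.\<close>

lemma sum_remove_ge:
  fixes f :: "'a \<Rightarrow> real"
  assumes "finite V" "A \<subseteq> V" "m \<le> card (V - A)" "0 \<le> c" "\<And>x. x \<in> V \<Longrightarrow> c \<le> f x"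
  shows "real m * c + sum f A \<le> sum f V"
proof -
  have "real m * c \<le> real (card (V - A)) * c"
    using assms by (intro mult_right_mono) auto
  also have "\<dots> \<le> sum f (V - A)"
    using assms by (intro sum_bounded_below) auto
  finally show ?thesis
    using sum.subset_diff[OF assms(2,1), of f] by simp
qed

context graph
begin

lemma min_degree_powr_le:
  assumes "0 \<le> \<alpha>" "u \<in> verts G"
  shows "real (min_degree G) powr (2 * \<alpha>) \<le> real (degree G u) powr (2 * \<alpha>)"
  using assms by (intro powr_mono2) (auto simp: min_degree_le)

lemma Zagreb_ge:
  assumes "0 \<le> \<alpha>" "verts G \<noteq> {}"
  shows "real (max_degree G) * real (min_degree G) powr (2 * \<alpha>)
      + real (max_degree G) powr (2 * \<alpha>) \<le> first_variable_Zagreb \<alpha> G"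
proof -
  obtain u where u: "u \<in> verts G" "degree G u = max_degree G"
    using obtain_max_degree assms(2) .
  have "max_degree G \<le> card (verts G - {u})"
    using degree_less_card_verts[OF u(1)] u by simp
  then show ?thesis
    unfolding first_variable_Zagreb_def
    using sum_remove_ge[of "verts G" "{u}" "max_degree G" "real (min_degree G) powr (2 * \<alpha>)"
        "\<lambda>v. real (degree G v) powr (2 * \<alpha>)"] u assms min_degree_powr_le
    by simp
qed

lemma Zagreb_ge_odd:
  assumes "0 \<le> \<alpha>" "verts G \<noteq> {}" "odd (max_degree G)" "even (min_degree G)"
  shows "(real (max_degree G) - 1) * real (min_degree G) powr (2 * \<alpha>)
      + real (min_degree G + 1) powr (2 * \<alpha>) + real (max_degree G) powr (2 * \<alpha>)
    \<le> first_variable_Zagreb \<alpha> G"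
proof -
  obtain u where u: "u \<in> verts G" "degree G u = max_degree G"
    using obtain_max_degree assms(2) .
  define W where "W = {v \<in> verts G. odd (degree G v)}"
  \<comment> \<open>An even degree sum has an even number of odd summands, so \<open>u\<close>
    cannot be the only vertex of odd degree.\<close>
  have "even (card W)"
    using even_sum_degree by (simp add: W_def even_sum_iff)
  moreover have "u \<in> W"
    using u assms by (simp add: W_def)
  ultimately have "W \<noteq> {u}"
    by auto
  then obtain w where w: "w \<in> verts G" "odd (degree G w)" "w \<noteq> u"
    using \<open>u \<in> W\<close> by (auto simp: W_def)
  \<comment> \<open>An odd degree differs from the even minimum, hence exceeds it by at least
    1.\<close>
  then have w_ge: "min_degree G + 1 \<le> degree G w"
    using min_degree_le[OF w(1)] assms(4) by (cases "degree G w = min_degree G") auto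
  have "max_degree G - 1 \<le> card (verts G - {u, w})"
    using degree_less_card_verts[OF u(1)] u w by (simp add: card_Diff_subset)
  then have "real (max_degree G - 1) * real (min_degree G) powr (2 * \<alpha>)
      + (\<Sum>v\<in>{u, w}. real (degree G v) powr (2 * \<alpha>)) \<le> first_variable_Zagreb \<alpha> G"
    unfolding first_variable_Zagreb_def using u w assms
    by (intro sum_remove_ge) (auto simp: min_degree_powr_le)
  moreover have "real (min_degree G + 1) powr (2 * \<alpha>) \<le> real (degree G w) powr (2 * \<alpha>)"
    using w_ge assms by (intro powr_mono2) auto
  moreover have "real (max_degree G - 1) = real (max_degree G) - 1"
    using odd_pos[OF assms(3)] by (simp add: of_nat_diff)
  ultimately show ?thesis
    using u w by simp
qed

end

section \<open>Extremal graphs\<close>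

text \<open>With truncated subtraction, \<open>(i - j) + (j - i)\<close> is \<open>\<bar>i - j\<bar>\<close>.\<close>

definition dist_nbrs :: "nat \<Rightarrow> nat set \<Rightarrow> nat \<Rightarrow> nat set" where
  "dist_nbrs n D i = {j. j < n \<and> (i - j) + (j - i) \<in> D}"

text \<open>The base graph lives on \<open>{..<n}\<close> and \<open>n\<close> is the apex. Taking
  arcs to be pairs of vertices excludes parallel arcs.\<close>

definition dist_cone :: "nat \<Rightarrow> nat set \<Rightarrow> (nat, nat \<times> nat) pre_digraph" where
  "dist_cone n D = \<lparr>verts = {..n},
     arcs = (SIGMA i:{..<n}. dist_nbrs n D i) \<union> {..<n} \<times> {n} \<union> {n} \<times> {..<n},
     tail = fst, head = snd\<rparr>"

lemma finite_dist_nbrs [simp]: "finite (dist_nbrs n D i)"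
  by (simp add: dist_nbrs_def)

text \<open>Symmetry holds because |i - j| is symmetric, \<open>0 \<notin> D\<close> excludes loops,
  and for \<open>0 < n\<close> the apex has an arc.\<close>

lemma nontrivial_graph_dist_cone:
  assumes "0 \<notin> D" "0 < n"
  shows "nontrivial_graph (dist_cone n D)"
proof -
  have "graph (dist_cone n D)"
    using assms(1) by unfold_locales
      (auto simp: dist_cone_def dist_nbrs_def arc_to_ends_def symmetric_def arcs_ends_conv sym_def add.commute)
  then show ?thesis
    using assms(2) by (auto simp: nontrivial_graph_def dist_cone_def)
qed

lemma degree_dist_cone_apex: "degree (dist_cone n D) n = n"
proof -
  have "out_arcs (dist_cone n D) n = {n} \<times> {..<n}"
    by (auto simp: dist_cone_def out_arcs_def)
  then show ?thesis
    by (simp add: degree_def out_degree_def card_cartesian_product)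
qed

lemma degree_dist_cone:
  assumes "i < n"
  shows "degree (dist_cone n D) i = Suc (card (dist_nbrs n D i))"
proof -
  have "out_arcs (dist_cone n D) i = Pair i ` insert n (dist_nbrs n D i)"
    using assms by (auto simp: dist_cone_def out_arcs_def)
  then have "degree (dist_cone n D) i = card (insert n (dist_nbrs n D i))"
    by (metis degree_def out_degree_def card_image Pair_inject inj_onI)
  also have "n \<notin> dist_nbrs n D i"
    by (simp add: dist_nbrs_def)
  then have "card (insert n (dist_nbrs n D i)) = Suc (card (dist_nbrs n D i))"
    by simp
  finally show ?thesis .
qed

lemma degree_image_dist_cone:
  "degree (dist_cone n D) ` verts (dist_cone n D)
    = insert n ((\<lambda>i. Suc (card (dist_nbrs n D i))) ` {..<n})"
proof -
  have "verts (dist_cone n D) = insert n {..<n}"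
    by (auto simp: dist_cone_def)
  then show ?thesis
    by (simp add: degree_dist_cone_apex degree_dist_cone cong: image_cong_simp)
qed

lemma Zagreb_dist_cone:
  "first_variable_Zagreb \<alpha> (dist_cone n D)
    = (\<Sum>i<n. real (Suc (card (dist_nbrs n D i))) powr (2 * \<alpha>)) + real n powr (2 * \<alpha>)"
proof -
  have "verts (dist_cone n D) = insert n {..<n}"
    by (auto simp: dist_cone_def)
  then show ?thesis
    by (simp add: first_variable_Zagreb_def degree_dist_cone_apex degree_dist_cone)
qed

section \<open>Regular and almost regular base graphs\<close>

text \<open>These distances join the vertices whose cyclic distance modulo \<open>n\<close> is
  between 1 and \<open>h\<close>. As |i - j| is not reduced modulo \<open>n\<close>, the wrap-around
  distances from \<open>n - h\<close> on must be listed too.\<close>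

definition circulant_dists :: "nat \<Rightarrow> nat \<Rightarrow> nat set" where
  "circulant_dists n h = {1..h} \<union> {n - h..<n}"

lemma card_dist_nbrs_circulant:
  assumes "i < n" "2 * h < n"
  shows "card (dist_nbrs n (circulant_dists n h) i) = 2 * h"
proof -
  \<comment> \<open>This is \<open>(i + s) mod n\<close> for \<open>s < n\<close>. It maps the
    distance set bijectively onto the neighbours of \<open>i\<close>, because that set is closed
    under replacing \<open>s\<close> by \<open>n - s\<close>.\<close>
  define shift where "shift s = (if i + s < n then i + s else i + s - n)" for s
  have inj: "inj_on shift (circulant_dists n h)"
    using assms by (auto simp: inj_on_def shift_def circulant_dists_def split: if_splits)
  have "dist_nbrs n (circulant_dists n h) i = shift ` circulant_dists n h"
  proof (intro set_eqI iffI)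
    fix j assume "j \<in> dist_nbrs n (circulant_dists n h) i"
    then have j: "j < n" "(i - j) + (j - i) \<in> circulant_dists n h"
      by (auto simp: dist_nbrs_def)
    define s where "s = (if i \<le> j then j - i else j + n - i)"
    have "j = shift s" "s \<in> circulant_dists n h"
      using j assms by (auto simp: s_def shift_def circulant_dists_def)
    then show "j \<in> shift ` circulant_dists n h"
      by blast
  next
    fix j assume "j \<in> shift ` circulant_dists n h"
    then show "j \<in> dist_nbrs n (circulant_dists n h) i"
      using assms by (auto simp: shift_def dist_nbrs_def circulant_dists_def split: if_splits)
  qed
  \<comment> \<open>The two ranges are disjoint because \<open>2 * h < n\<close>.\<close>
  moreover have "card (circulant_dists n h) = 2 * h"
    unfolding circulant_dists_def using assms by (subst card_Un_disjoint) auto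
  ultimately show ?thesis
    using inj by (simp add: card_image)
qed

text \<open>The distance \<open>m\<close> lies strictly between \<open>h\<close> and
  \<open>n - h\<close>, so it contributes only new neighbours.\<close>

lemma card_dist_nbrs_insert:
  assumes "i < n" "h < m" "m + h < n"
  shows "card (dist_nbrs n (insert m (circulant_dists n h)) i)
    = 2 * h + card (dist_nbrs n {m} i)"
proof -
  have "dist_nbrs n (insert m (circulant_dists n h)) i
      = dist_nbrs n (circulant_dists n h) i \<union> dist_nbrs n {m} i"
    by (auto simp: dist_nbrs_def)
  moreover have "dist_nbrs n (circulant_dists n h) i \<inter> dist_nbrs n {m} i = {}"
    using assms by (auto simp: dist_nbrs_def circulant_dists_def)
  ultimately show ?thesis
    using assms by (simp add: card_Un_disjoint card_dist_nbrs_circulant)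
qed

lemma dist_nbrs_singleton: "dist_nbrs n {m} i = {j. j < n \<and> (j = i + m \<or> i = j + m)}"
  unfolding dist_nbrs_def by (rule Collect_cong) (simp, arith)

text \<open>For even \<open>k\<close> a circulant graph suffices. For odd \<open>k\<close> the
  number \<open>n\<close> is even, and the distance \<open>n / 2\<close> adds a perfect
  matching.\<close>

lemma regular_dists_exist:
  assumes "even (n * k)" "k < n"
  obtains D where "0 \<notin> D" "\<And>i. i < n \<Longrightarrow> card (dist_nbrs n D i) = k"
proof (cases "even k")
  case True
  then obtain h where "k = 2 * h"
    by blast
  then show ?thesis
    using that[of "circulant_dists n h"] assms card_dist_nbrs_circulant[of _ n h]
    by (auto simp: circulant_dists_def)
next
  case False
  then obtain h m where k: "k = 2 * h + 1" and n: "n = 2 * m"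
    using assms(1) by (auto elim!: oddE)
  show ?thesis
  proof (rule that)
    show "0 \<notin> insert m (circulant_dists n h)"
      using assms k n by (auto simp: circulant_dists_def)
    fix i assume "i < n"
    have "dist_nbrs n {m} i = {if i < m then i + m else i - m}"
      using \<open>i < n\<close> n by (auto simp: dist_nbrs_singleton)
    then show "card (dist_nbrs n (insert m (circulant_dists n h)) i) = k"
      using assms k n \<open>i < n\<close> by (simp add: card_dist_nbrs_insert)
  qed
qed

text \<open>With \<open>n = 2 * m + 1\<close>, the distance \<open>m\<close> alone, without its
  cyclic counterpart \<open>m + 1\<close>, joins the middle vertex \<open>m\<close> to both
  \<open>0\<close> and \<open>2 * m\<close> and gives every other vertex a single neighbour. Added
  to a circulant graph, it makes \<open>m\<close> the exceptional vertex.\<close>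

lemma almost_regular_dists_exist:
  assumes "odd n" "odd k" "k < n"
  obtains D c where "0 \<notin> D" "c < n"
    "\<And>i. i < n \<Longrightarrow> card (dist_nbrs n D i) = (if i = c then k + 1 else k)"
proof -
  obtain h m where k: "k = 2 * h + 1" and n: "n = 2 * m + 1"
    using assms by (auto elim!: oddE)
  show ?thesis
  proof (rule that)
    show "0 \<notin> insert m (circulant_dists n h)" "m < n"
      using assms k n by (auto simp: circulant_dists_def)
    fix i assume "i < n"
    have "dist_nbrs n {m} i
        = (if i = m then {0, 2 * m} else {if i < m then i + m else i - m})"
      using \<open>i < n\<close> n by (auto simp: dist_nbrs_singleton)
    then show "card (dist_nbrs n (insert m (circulant_dists n h)) i)
        = (if i = m then k + 1 else k)"
      using assms k n \<open>i < n\<close> by (simp add: card_dist_nbrs_insert)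
  qed
qed

section \<open>Cones attaining the bounds, and the conclusion\<close>

lemma Zagreb_extremal_exists:
  assumes "even (\<Delta> * (\<delta> + 1))" "1 \<le> \<delta>" "\<delta> \<le> \<Delta>"
  shows "\<exists>G :: (nat, nat \<times> nat) pre_digraph.
    nontrivial_graph G \<and> min_degree G = \<delta> \<and> max_degree G = \<Delta> \<and>
    first_variable_Zagreb \<alpha> G = real \<Delta> * real \<delta> powr (2 * \<alpha>) + real \<Delta> powr (2 * \<alpha>)"
proof -
  \<comment> \<open>The apex adds 1 to each base degree, so the base must be regular of degree
    \<open>\<delta> - 1\<close>, which has the parity of \<open>\<delta> + 1\<close>.\<close>
  have "even (\<Delta> * (\<delta> - 1))" "\<delta> - 1 < \<Delta>"
    using assms by auto
  then obtain D where D: "0 \<notin> D" "\<And>i. i < \<Delta> \<Longrightarrow> card (dist_nbrs \<Delta> D i) = \<delta> - 1"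
    using regular_dists_exist by metis
  let ?G = "dist_cone \<Delta> D"
  have "(\<lambda>i. Suc (card (dist_nbrs \<Delta> D i))) ` {..<\<Delta>} = (\<lambda>i. \<delta>) ` {..<\<Delta>}"
    using D assms by (intro image_cong) auto
  also have "\<dots> = {\<delta>}"
    using assms by (intro image_constant[of 0]) auto
  finally have "degree ?G ` verts ?G = {\<Delta>, \<delta>}"
    unfolding degree_image_dist_cone by simp
  then have "min_degree ?G = \<delta>" "max_degree ?G = \<Delta>"
    using assms by (simp_all add: min_degree_def max_degree_def)
  moreover have "first_variable_Zagreb \<alpha> ?G
      = real \<Delta> * real \<delta> powr (2 * \<alpha>) + real \<Delta> powr (2 * \<alpha>)"
    unfolding Zagreb_dist_cone using D assms by simp
  ultimately show ?thesis
    using nontrivial_graph_dist_cone D assms by (intro exI[of _ ?G]) auto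
qed

lemma Zagreb_extremal_exists_odd:
  assumes "odd (\<Delta> * (\<delta> + 1))" "1 \<le> \<delta>" "\<delta> \<le> \<Delta>"
  shows "\<exists>G :: (nat, nat \<times> nat) pre_digraph.
    nontrivial_graph G \<and> min_degree G = \<delta> \<and> max_degree G = \<Delta> \<and>
    first_variable_Zagreb \<alpha> G = (real \<Delta> - 1) * real \<delta> powr (2 * \<alpha>)
      + real (\<delta> + 1) powr (2 * \<alpha>) + real \<Delta> powr (2 * \<alpha>)"
proof -
  have \<delta>: "even \<delta>" "odd \<Delta>" "odd (\<delta> - 1)" "\<delta> - 1 < \<Delta>"
    using assms by auto
  \<comment> \<open>Opposite parities exclude equality. Hence
    \<open>\<delta> + 1 \<le> \<Delta>\<close>, and the exceptional vertex does not raise the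
    maximum degree.\<close>
  then have "\<delta> < \<Delta>"
    using assms(3) by (cases "\<delta> = \<Delta>") auto
  obtain D c where D: "0 \<notin> D" "c < \<Delta>"
    "\<And>i. i < \<Delta> \<Longrightarrow> card (dist_nbrs \<Delta> D i) = (if i = c then \<delta> - 1 + 1 else \<delta> - 1)"
    using almost_regular_dists_exist[OF \<delta>(2-4)] by metis
  let ?G = "dist_cone \<Delta> D"
  have deg: "Suc (card (dist_nbrs \<Delta> D i)) = (if i = c then \<delta> + 1 else \<delta>)" if "i < \<Delta>" for i
    using D that assms by simp
  \<comment> \<open>Since \<open>1 \<le> \<delta> < \<Delta>\<close>, the base has a vertex besides
    \<open>c\<close>; it realises the minimum degree \<open>\<delta>\<close>.\<close>
  obtain d where "d < \<Delta>" "d \<noteq> c"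
    using \<open>\<delta> < \<Delta>\<close> assms(2) by (metis less_one less_trans nat_neq_iff not_le order_le_less_trans)
  have "(\<lambda>i. Suc (card (dist_nbrs \<Delta> D i))) ` {..<\<Delta>} = {\<delta>, \<delta> + 1}"
  proof
    show "{\<delta>, \<delta> + 1} \<subseteq> (\<lambda>i. Suc (card (dist_nbrs \<Delta> D i))) ` {..<\<Delta>}"
      using deg[of c] deg[of d] \<open>c < \<Delta>\<close> \<open>d < \<Delta>\<close> \<open>d \<noteq> c\<close>
      by (auto simp: image_iff intro: bexI[of _ c] bexI[of _ d])
  qed (auto simp: deg simp del: One_nat_def)
  then have "degree ?G ` verts ?G = {\<Delta>, \<delta>, \<delta> + 1}"
    unfolding degree_image_dist_cone by simp
  then have "min_degree ?G = \<delta>" "max_degree ?G = \<Delta>"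
    using \<open>\<delta> < \<Delta>\<close> by (simp_all add: min_degree_def max_degree_def)
  moreover have "first_variable_Zagreb \<alpha> ?G = (real \<Delta> - 1) * real \<delta> powr (2 * \<alpha>)
      + real (\<delta> + 1) powr (2 * \<alpha>) + real \<Delta> powr (2 * \<alpha>)"
  proof -
    have "(\<Sum>i<\<Delta>. real (Suc (card (dist_nbrs \<Delta> D i))) powr (2 * \<alpha>))
        = (\<Sum>i<\<Delta>. if i = c then real (\<delta> + 1) powr (2 * \<alpha>) else real \<delta> powr (2 * \<alpha>))"
      by (intro sum.cong refl) (subst deg, auto)
    also have "\<dots> = real (\<delta> + 1) powr (2 * \<alpha>) + (\<Sum>i\<in>{..<\<Delta>} - {c}. real \<delta> powr (2 * \<alpha>))"
      using \<open>c < \<Delta>\<close> by (subst sum.remove[of _ c]) auto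
    also have "(\<Sum>i\<in>{..<\<Delta>} - {c}. real \<delta> powr (2 * \<alpha>)) = (real \<Delta> - 1) * real \<delta> powr (2 * \<alpha>)"
      using \<open>c < \<Delta>\<close> by (simp add: of_nat_diff)
    finally show ?thesis
      unfolding Zagreb_dist_cone by simp
  qed
  ultimately show ?thesis
    using nontrivial_graph_dist_cone D by (intro exI[of _ ?G]) auto
qed

text \<open>The tail of any arc is a vertex; nonemptiness guarantees that the maximum degree is
  attained.\<close>

lemma nontrivial_graphD:
  assumes "nontrivial_graph G"
  shows "graph G" "verts G \<noteq> {}"
proof -
  show "graph G"
    using assms by (simp add: nontrivial_graph_def)
  then interpret graph G .
  show "verts G \<noteq> {}"
    using assms tail_in_verts by (fastforce simp: nontrivial_graph_def)
qed

theorem theorem3p1: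
  fixes \<alpha> :: real and \<delta> \<Delta> :: nat
  assumes "\<alpha> > 0" and "1 \<le> \<delta>" and "\<delta> \<le> \<Delta>"
  shows
    "(even (\<Delta> * (\<delta> + 1)) \<longrightarrow>
      (\<forall>G :: ('a, 'b) pre_digraph.
        nontrivial_graph G \<and> min_degree G = \<delta> \<and> max_degree G = \<Delta> \<longrightarrow>
        first_variable_Zagreb \<alpha> G \<ge>
          real \<Delta> * real \<delta> powr (2 * \<alpha>) + real \<Delta> powr (2 * \<alpha>)) \<and>
      (\<exists>G :: (nat, nat \<times> nat) pre_digraph.
        nontrivial_graph G \<and> min_degree G = \<delta> \<and> max_degree G = \<Delta> \<and>
        first_variable_Zagreb \<alpha> G =
          real \<Delta> * real \<delta> powr (2 * \<alpha>) + real \<Delta> powr (2 * \<alpha>))) \<and>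
     (odd (\<Delta> * (\<delta> + 1)) \<longrightarrow>
      (\<forall>G :: ('a, 'b) pre_digraph.
        nontrivial_graph G \<and> min_degree G = \<delta> \<and> max_degree G = \<Delta> \<longrightarrow>
        first_variable_Zagreb \<alpha> G \<ge>
          (real \<Delta> - 1) * real \<delta> powr (2 * \<alpha>) + real (\<delta> + 1) powr (2 * \<alpha>)
            + real \<Delta> powr (2 * \<alpha>)) \<and>
      (\<exists>G :: (nat, nat \<times> nat) pre_digraph.
        nontrivial_graph G \<and> min_degree G = \<delta> \<and> max_degree G = \<Delta> \<and>
        first_variable_Zagreb \<alpha> G =
          (real \<Delta> - 1) * real \<delta> powr (2 * \<alpha>) + real (\<delta> + 1) powr (2 * \<alpha>)
            + real \<Delta> powr (2 * \<alpha>)))"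
proof (intro conjI impI allI)
  show "real \<Delta> * real \<delta> powr (2 * \<alpha>) + real \<Delta> powr (2 * \<alpha>) \<le> first_variable_Zagreb \<alpha> G"
    if "nontrivial_graph G \<and> min_degree G = \<delta> \<and> max_degree G = \<Delta>" for G :: "('a, 'b) pre_digraph"
    using graph.Zagreb_ge[of G \<alpha>] nontrivial_graphD[of G] that \<open>\<alpha> > 0\<close> by auto
  show "(real \<Delta> - 1) * real \<delta> powr (2 * \<alpha>) + real (\<delta> + 1) powr (2 * \<alpha>)
      + real \<Delta> powr (2 * \<alpha>) \<le> first_variable_Zagreb \<alpha> G"
    if "odd (\<Delta> * (\<delta> + 1))" "nontrivial_graph G \<and> min_degree G = \<delta> \<and> max_degree G = \<Delta>"
    for G :: "('a, 'b) pre_digraph"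
    using graph.Zagreb_ge_odd[of G \<alpha>] nontrivial_graphD[of G] that \<open>\<alpha> > 0\<close> by auto
\<comment> \<open>Only the two sharpness claims remain, one for each parity.\<close>
qed (rule Zagreb_extremal_exists Zagreb_extremal_exists_odd, assumption, (rule assms)+)+

end
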